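(* Let $(a_n)_{n\ge1}$ and $(b_n)_{n\ge1}$ be sequences of positive integers and let $\tau$ be the generalized continued fraction \[ \tau=\cfrac{a_1}{b_1+\cfrac{a_2}{b_2+\cdots}}. \] Suppose \[ a_n\le r\alpha^{n^{l}},\qquad s_1\beta_1^{n^{k_1}}\le b_n\le s_2\beta_2^{n^{k_2}} \] for all $n\in\mathbb{Z}^+$, where $l$ is a non-negative real number and $r,s_1,s_2,\alpha,\beta_1,\beta_2,k_1,k_2$ are positive real numbers satisfying $k_1+1>k_2\ge k_1$. (1) If $l<k_1$, then $\tau$ is irrational and $\mu_I(\tau)=2$. (2) If $l=k_1$ and $\alpha<\beta_1$, then $\tau$ is irrational and \[ \mu_I(\tau)\le 2+\frac{\log\alpha}{\log\beta_1-\log\alpha}. \]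
   Context: The value of the generalized continued fraction is the limit $\lim_{n\to\infty}A_n/B_n$ of its convergents, when this limit exists, where $A_0=0$, $B_0=1$, $A_1=a_1$, $B_1=b_1$ and $A_{n+2}=b_{n+2}A_{n+1}+a_{n+2}A_n$, $B_{n+2}=b_{n+2}B_{n+1}+a_{n+2}B_n$ for $n\ge 0$. For a real number $\tau$, an irrationality exponent of $\tau$ is any $\mu$ for which there exist positive constants $c$ and $N_0$ such that $\left|\tau-\frac{M}{N}\right|\ge \frac{c}{N^{\mu}}$ for all $M,N\in\mathbb{Z}$ with $N\ge N_0$. The asymptotic irrationality exponent $\mu_I(\tau)$ is the infimum of all irrationality exponents $\mu$ of $\tau$, where the infimum of the empty set is interpreted as $\infty$.
   Formalization: Part (1) is proved under the additional hypothesis β₁ > 1; without it the claim is false, e.g. a_n = 2, b_n = 1, l = 0, r = 2, k₁ = k₂ = 1 and α, s₁, s₂, β₁, β₂ all equal to 1 gives τ = 1, which is rational. *)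

theory Defs
  imports Complex_Main "HOL-Library.Extended_Real"
begin

text \<open>
  Sequences \<open>(a\<^sub>n)\<close>, \<open>(b\<^sub>n)\<close> with \<open>n \<ge> 1\<close> are functions on \<^typ>\<open>nat\<close> whose value at \<open>0\<close> is
  never used.
\<close>

fun gcf_num :: "(nat \<Rightarrow> int) \<Rightarrow> (nat \<Rightarrow> int) \<Rightarrow> nat \<Rightarrow> int" where
  "gcf_num a b 0 = 0"
| "gcf_num a b (Suc 0) = a 1"
| "gcf_num a b (Suc (Suc n)) = b (n + 2) * gcf_num a b (Suc n) + a (n + 2) * gcf_num a b n"

fun gcf_denom :: "(nat \<Rightarrow> int) \<Rightarrow> (nat \<Rightarrow> int) \<Rightarrow> nat \<Rightarrow> int" where
  "gcf_denom a b 0 = 1"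
| "gcf_denom a b (Suc 0) = b 1"
| "gcf_denom a b (Suc (Suc n)) = b (n + 2) * gcf_denom a b (Suc n) + a (n + 2) * gcf_denom a b n"

definition gcf_conv :: "(nat \<Rightarrow> int) \<Rightarrow> (nat \<Rightarrow> int) \<Rightarrow> nat \<Rightarrow> real" where
  "gcf_conv a b n = real_of_int (gcf_num a b n) / real_of_int (gcf_denom a b n)"

text \<open>Meaningful only if \<^term>\<open>convergent (gcf_conv a b)\<close>; otherwise an unspecified real.\<close>

definition gcf_value :: "(nat \<Rightarrow> int) \<Rightarrow> (nat \<Rightarrow> int) \<Rightarrow> real" where
  "gcf_value a b = lim (gcf_conv a b)"

definition irrationality_exponent :: "real \<Rightarrow> real \<Rightarrow> bool" where
  "irrationality_exponent \<tau> \<mu> \<longleftrightarrow>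
     (\<exists>c>0. \<exists>N\<^sub>0>0. \<forall>M N :: int. real_of_int N \<ge> N\<^sub>0 \<longrightarrow>
        \<bar>\<tau> - real_of_int M / real_of_int N\<bar> \<ge> c / real_of_int N powr \<mu>)"

text \<open>In \<^typ>\<open>ereal\<close> the infimum of the empty set is \<open>\<infinity>\<close>.\<close>

definition asymp_irrationality_exponent :: "real \<Rightarrow> ereal" where
  "asymp_irrationality_exponent \<tau> = Inf (ereal ` {\<mu>. irrationality_exponent \<tau> \<mu>})"

end

theory Submission
  imports Defs "HOL-Analysis.Kronecker_Approximation_Theorem" "HOL-Real_Asymp.Real_Asymp"
begin

text \<open>
  Write \<open>A n / B n\<close> for the convergents and \<open>P n = a 1 * \<dots> * a n\<close>. The determinant identity
  \<open>A (n + 1) * B n - A n * B (n + 1) = (-1) ^ n * P (n + 1)\<close> shows that the convergents are the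
  partial sums of an alternating series with decreasing terms. Hence, once \<open>P n / B n\<close> tends to
  \<open>0\<close>, the value \<open>\<tau>\<close> exists and \<open>\<bar>B n * \<tau> - A n\<bar> \<le> P (n + 1) / B (n + 1)\<close> (\<open>gcf_error\<close>).

  Upper bound on the irrationality exponent. Let \<open>M / N\<close> be a fraction and let \<open>n\<close> be the last
  index with \<open>B n / P n < 2 * N\<close>. At the indices \<open>m = n\<close> and \<open>m = n + 1\<close> the error
  \<open>N * \<bar>B m * \<tau> - A m\<bar>\<close> is at most \<open>1/2\<close>, and for at least one of them the integer
  \<open>M * B m - N * A m\<close> is nonzero, because the determinant is. For that \<open>m\<close> the fraction \<open>M / N\<close>
  stays away from \<open>\<tau>\<close> by at least \<open>1 / (2 * N * B m) \<ge> 1 / (2 * N * B (n + 1))\<close>. So \<open>\<mu>\<close> is an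
  irrationality exponent as soon as \<open>B (n + 1)\<close> is eventually at most \<open>(B n / P n) powr (\<mu> - 1)\<close>
  (\<open>irrationality_exponentI\<close>).

  Growth. Let \<open>S n\<close> be the sum of \<open>i powr k\<^sub>1\<close> for \<open>1 \<le> i \<le> n\<close>, which is of exact order
  \<open>n powr (k\<^sub>1 + 1)\<close>. Then \<open>ln (B n) \<ge> D * S n - o(S n)\<close> with \<open>D = ln \<beta>\<^sub>1\<close>, and
  \<open>ln (P n) \<le> C * S n + o(S n)\<close> with \<open>C = ln \<alpha>\<close> if \<open>l = k\<^sub>1\<close> and \<open>C = 0\<close> if \<open>l < k\<^sub>1\<close>. The
  hypothesis \<open>k\<^sub>2 < k\<^sub>1 + 1\<close> makes a single step \<open>ln (B (n + 1)) - ln (B n)\<close> negligible against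
  \<open>S n\<close>. Comparing the coefficients of \<open>S n\<close>, every \<open>\<mu> > 2 + C / (D - C)\<close> satisfies the
  criterion (\<open>gcf_log_growth\<close>).

  Irrationality is then automatic, since a rational number has no irrationality exponent at all,
  and Dirichlet's approximation theorem gives the lower bound \<open>2\<close>
  (\<open>irrationality_exponent_ge_2\<close>).
\<close>

section \<open>Irrationality exponents\<close>

text \<open>
  A rational number equals fractions with arbitrarily large denominators, obtained by expanding
  its own representation, and these violate any positive lower bound.
\<close>

lemma irrationality_exponent_imp_irrational:
  assumes "irrationality_exponent \<tau> \<mu>"
  shows "\<tau> \<notin> \<rat>"
proof
  assume "\<tau> \<in> \<rat>"
  then obtain p q :: int where q: "q > 0" and \<tau>: "\<tau> = of_int p / of_int q"
    by (auto elim: Rats_cases')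
  from assms obtain c N0 where c: "c > 0" "N0 > 0"
    and *: "\<And>M N :: int. real_of_int N \<ge> N0 \<Longrightarrow> \<bar>\<tau> - of_int M / of_int N\<bar> \<ge> c / of_int N powr \<mu>"
    unfolding irrationality_exponent_def by blast
  define k where "k = \<lceil>N0\<rceil>"
  have k: "real_of_int k \<ge> N0" "k > 0"
    using c by (auto simp: k_def)
  have "N0 \<le> real_of_int k" by fact
  also have "real_of_int k \<le> real_of_int (k * q)"
    using k q by simp
  finally have "\<bar>\<tau> - of_int (k * p) / of_int (k * q)\<bar> \<ge> c / of_int (k * q) powr \<mu>"
    by (rule *)
  moreover have "\<tau> - of_int (k * p) / of_int (k * q) = 0"
    using k q by (simp add: \<tau>)
  ultimately have "c / of_int (k * q) powr \<mu> \<le> 0" by simp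
  moreover have "c / of_int (k * q) powr \<mu> > 0"
    using c k q by simp
  ultimately show False by simp
qed

text \<open>
  Dirichlet's theorem gives \<open>\<bar>k * \<tau> - h\<bar> < 1 / K\<close> with \<open>1 \<le> k \<le> K\<close>. For an exponent \<open>\<mu> < 2\<close>
  the lower bound on \<open>\<bar>\<tau> - h / k\<bar>\<close> would force \<open>K\<close> to be at most a constant times
  \<open>K powr \<nu>\<close> with some \<open>\<nu> < 1\<close>, for every \<open>K\<close>.
\<close>

lemma irrationality_exponent_ge_2:
  assumes "irrationality_exponent \<tau> \<mu>"
  shows "\<mu> \<ge> 2"
proof (rule ccontr)
  assume "\<not> \<mu> \<ge> 2"
  \<comment> \<open>Truncation at \<open>0\<close> makes \<open>x powr \<nu>\<close> monotone in \<open>x\<close>, also for \<open>\<mu> < 1\<close>.\<close>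
  define \<nu> where "\<nu> = max 0 (\<mu> - 1)"
  have \<nu>: "\<nu> \<ge> 0" "\<nu> < 1" "\<mu> - 1 \<le> \<nu>" using \<open>\<not> \<mu> \<ge> 2\<close> by (auto simp: \<nu>_def)
  from assms obtain c N0 where c: "c > 0" "N0 > 0"
    and *: "\<And>M N :: int. real_of_int N \<ge> N0 \<Longrightarrow> \<bar>\<tau> - of_int M / of_int N\<bar> \<ge> c / of_int N powr \<mu>"
    unfolding irrationality_exponent_def by blast
  define j where "j = \<lceil>N0\<rceil>"
  have j: "real_of_int j \<ge> N0" "j > 0"
    using c by (auto simp: j_def)
  define C where "C = of_int j powr \<mu> / c"
  have C: "C > 0" using c j by (simp add: C_def)
  have bound: "real K < C * real K powr \<nu>" if K: "K > 0" for K :: nat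
  proof -
    obtain h k where k: "0 < k" "k \<le> int K" and hk: "\<bar>of_int k * \<tau> - of_int h\<bar> < 1 / K"
      using Dirichlet_approx[OF K] by blast
    have k1: "real_of_int k \<ge> 1" using k by simp
    \<comment> \<open>Scaling numerator and denominator by \<open>j\<close> puts the denominator above the threshold at
        the cost of a constant factor only.\<close>
    have "N0 \<le> real_of_int j" by fact
    also have "real_of_int j \<le> real_of_int (j * k)"
      using k j by simp
    finally have "c / of_int (j * k) powr \<mu> \<le> \<bar>\<tau> - of_int (j * h) / of_int (j * k)\<bar>"
      by (rule *)
    also have "\<tau> - of_int (j * h) / of_int (j * k) = (of_int k * \<tau> - of_int h) / of_int k"
      using j k by (simp add: field_simps)
    also have "\<bar>\<dots>\<bar> = \<bar>of_int k * \<tau> - of_int h\<bar> / of_int k"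
      using k by simp
    also have "\<dots> < 1 / K / of_int k"
      using hk k by (intro divide_strict_right_mono) auto
    finally have "c / (of_int j powr \<mu> * of_int k powr \<mu>) < 1 / (real K * of_int k)"
      using j k by (simp add: powr_mult)
    then have "real K < C * (of_int k powr \<mu> / of_int k)"
      using K k j c by (simp add: C_def field_simps)
    also have "of_int k powr \<mu> / of_int k = (of_int k :: real) powr (\<mu> - 1)"
      using k by (simp add: powr_diff)
    also have "\<dots> \<le> of_int k powr \<nu>"
      using \<nu> k1 by (intro powr_mono) auto
    also have "\<dots> \<le> real K powr \<nu>"
      using \<nu> k by (intro powr_mono2) auto
    finally show ?thesis using C by simp
  qed
  have "eventually (\<lambda>K. C * real K powr \<nu> < real K) at_top"
    using C \<nu> by real_asymp
  moreover have "eventually (\<lambda>K::nat. K > 0) at_top"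
    by (rule eventually_gt_at_top)
  ultimately have "eventually (\<lambda>K::nat. K > 0 \<and> C * real K powr \<nu> < real K) at_top"
    by eventually_elim simp
  then obtain K :: nat where "K > 0" "C * real K powr \<nu> < real K"
    using eventually_happens[of _ "at_top :: nat filter"] by auto
  with bound[of K] show False by simp
qed

section \<open>Generalized continued fractions with positive integer entries\<close>

locale positive_gcf =
  fixes a b :: "nat \<Rightarrow> int"
  assumes a_pos: "n \<ge> 1 \<Longrightarrow> a n > 0"
    and b_pos: "n \<ge> 1 \<Longrightarrow> b n > 0"
begin

abbreviation "A \<equiv> gcf_num a b"
abbreviation "B \<equiv> gcf_denom a b"

definition P :: "nat \<Rightarrow> int" where "P n = (\<Prod>i = 1..n. a i)"

lemma P_Suc: "P (Suc n) = a (Suc n) * P n"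
  by (simp add: P_def mult.commute)

lemma P_pos: "P n > 0"
  by (auto simp: P_def a_pos intro!: prod_pos)

lemma B_pos: "B n > 0"
proof -
  have "B n > 0 \<and> B (Suc n) > 0"
    by (induction n) (auto simp: a_pos b_pos intro!: add_pos_pos)
  then show ?thesis by simp
qed

lemma B_Suc_ge: "B (Suc n) \<ge> b (Suc n) * B n"
proof (cases n)
  case (Suc m)
  then show ?thesis
    using a_pos[of "m + 2"] B_pos[of m] by simp
qed simp

lemma B_le_Suc: "B n \<le> B (Suc n)"
proof -
  have "1 * B n \<le> b (Suc n) * B n"
    using b_pos[of "Suc n"] B_pos[of n] by (intro mult_right_mono) auto
  then show ?thesis using B_Suc_ge[of n] by simp
qed

text \<open>
  The sum of two positive integers is at most twice their product. In this product form the
  bound turns into a sum of logarithms in \<open>ln_B_Suc_le\<close>.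
\<close>

lemma B_Suc_le: "B (Suc n) \<le> 2 * (a (Suc n) * b (Suc n) * B n)"
proof -
  have "B (Suc n) \<le> (b (Suc n) + a (Suc n)) * B n"
  proof (cases n)
    case (Suc m)
    have "a (m + 2) * B m \<le> a (m + 2) * B (Suc m)"
      using a_pos[of "m + 2"] B_le_Suc[of m] by (intro mult_left_mono) auto
    with Suc show ?thesis by (simp add: algebra_simps)
  qed (use a_pos[of 1] in simp)
  also have "b (Suc n) + a (Suc n) \<le> 2 * (a (Suc n) * b (Suc n))"
  proof -
    have "a (Suc n) * 1 \<le> a (Suc n) * b (Suc n)" "1 * b (Suc n) \<le> a (Suc n) * b (Suc n)"
      using a_pos[of "Suc n"] b_pos[of "Suc n"]
      by (intro mult_left_mono mult_right_mono; simp)+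
    then show ?thesis by linarith
  qed
  finally show ?thesis
    using B_pos[of n] by (simp add: mult.assoc)
qed

lemma determinant: "A (Suc n) * B n - A n * B (Suc n) = (-1) ^ n * P (Suc n)"
proof (induction n)
  case 0
  then show ?case by (simp add: P_def)
next
  case (Suc n)
  have "A (Suc (Suc n)) * B (Suc n) - A (Suc n) * B (Suc (Suc n))
        = - a (Suc (Suc n)) * (A (Suc n) * B n - A n * B (Suc n))"
    by (simp add: algebra_simps)
  with Suc show ?case by (simp add: P_Suc)
qed

text \<open>
  The distance between the convergents of index \<open>n\<close> and \<open>n + 1\<close>.
\<close>

definition gap :: "nat \<Rightarrow> real" where
  "gap n = of_int (P (Suc n)) / (of_int (B n) * of_int (B (Suc n)))"

lemma gap_nonneg: "gap n \<ge> 0"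
  using P_pos[of "Suc n"] B_pos[of n] B_pos[of "Suc n"] by (simp add: gap_def)

lemma gcf_conv_Suc: "gcf_conv a b (Suc n) = gcf_conv a b n + (-1) ^ n * gap n"
proof -
  have "gcf_conv a b (Suc n) - gcf_conv a b n
        = of_int (A (Suc n) * B n - A n * B (Suc n)) / (of_int (B n) * of_int (B (Suc n)))"
    using B_pos[of n] B_pos[of "Suc n"]
    by (simp add: gcf_conv_def field_simps del: gcf_num.simps gcf_denom.simps)
  then show ?thesis
    by (simp add: determinant gap_def del: gcf_num.simps gcf_denom.simps)
qed

lemma gcf_conv_eq_sum: "gcf_conv a b n = (\<Sum>i<n. (-1) ^ i * gap i)"
  by (induction n) (simp_all add: gcf_conv_Suc, simp add: gcf_conv_def)

text \<open>
  The quotient of consecutive gaps is \<open>a (n + 2) * B n / B (n + 2)\<close>, and the numerator is one of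
  the two summands of \<open>B (n + 2)\<close>.
\<close>

lemma gap_Suc_le: "gap (Suc n) \<le> gap n"
proof -
  have "a (Suc (Suc n)) * B n \<le> B (Suc (Suc n))"
    using b_pos[of "n + 2"] B_pos[of "Suc n"] by simp
  then have "of_int (a (Suc (Suc n)) * B n) \<le> (of_int (B (Suc (Suc n))) :: real)"
    by (simp only: of_int_le_iff)
  then have "of_int (P (Suc n)) * (of_int (a (Suc (Suc n)) * B n) :: real)
             \<le> of_int (P (Suc n)) * of_int (B (Suc (Suc n)))"
    using P_pos[of "Suc n"] by (intro mult_left_mono) auto
  then show ?thesis
    using B_pos[of n] B_pos[of "Suc n"] B_pos[of "Suc (Suc n)"]
    by (simp add: gap_def P_Suc[of "Suc n"] field_simps del: gcf_denom.simps)
qed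

lemma gap_tendsto_0:
  assumes "(\<lambda>n. of_int (P n) / of_int (B n) :: real) \<longlonglongrightarrow> 0"
  shows "gap \<longlonglongrightarrow> 0"
proof (rule tendsto_sandwich[OF _ _ tendsto_const LIMSEQ_Suc[OF assms]])
  show "eventually (\<lambda>n. 0 \<le> gap n) sequentially"
    by (simp add: gap_nonneg)
  have "gap n \<le> of_int (P (Suc n)) / of_int (B (Suc n))" for n
  proof -
    have "gap n = of_int (P (Suc n)) / of_int (B (Suc n)) / of_int (B n)"
      by (simp add: gap_def)
    also have "\<dots> \<le> of_int (P (Suc n)) / of_int (B (Suc n)) / 1"
      using P_pos[of "Suc n"] B_pos[of n] B_pos[of "Suc n"] by (intro divide_left_mono) auto
    finally show ?thesis by simp
  qed
  then show "eventually (\<lambda>n. gap n \<le> of_int (P (Suc n)) / of_int (B (Suc n))) sequentially"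
    by simp
qed

text \<open>
  The value lies between any two consecutive convergents, by the Leibniz criterion for
  alternating series.
\<close>

lemma
  assumes "(\<lambda>n. of_int (P n) / of_int (B n) :: real) \<longlonglongrightarrow> 0"
  shows gcf_convergent: "convergent (gcf_conv a b)"
    and gcf_error: "\<bar>gcf_value a b - gcf_conv a b n\<bar> \<le> gap n"
proof -
  note leibniz = summable_Leibniz'[of gap, OF gap_tendsto_0[OF assms] gap_nonneg gap_Suc_le]
  have "(\<lambda>n. \<Sum>i<n. (-1) ^ i * gap i) \<longlonglongrightarrow> (\<Sum>i. (-1) ^ i * gap i)"
    using leibniz(1) by (rule summable_LIMSEQ)
  then have lim: "gcf_conv a b \<longlonglongrightarrow> (\<Sum>i. (-1) ^ i * gap i)"
    by (simp add: gcf_conv_eq_sum[abs_def])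
  then show "convergent (gcf_conv a b)"
    by (rule convergentI)
  from lim have val: "gcf_value a b = (\<Sum>i. (-1) ^ i * gap i)"
    unfolding gcf_value_def by (rule limI)
  show "\<bar>gcf_value a b - gcf_conv a b n\<bar> \<le> gap n"
  proof (cases "even n")
    case True
    then obtain m where "n = 2 * m" by (elim evenE)
    then show ?thesis
      using leibniz(2)[of m] leibniz(4)[of m] gcf_conv_Suc[of n]
      by (simp add: val gcf_conv_eq_sum del: sum.lessThan_Suc)
  next
    case False
    then obtain m where "n = 2 * m + 1" by (elim oddE)
    then show ?thesis
      using leibniz(4)[of m] leibniz(2)[of "Suc m"] gcf_conv_Suc[of n]
      by (simp add: val gcf_conv_eq_sum del: sum.lessThan_Suc)
  qed
qed

section \<open>Irrationality exponents from the growth of the denominators\<close>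

text \<open>
  The nonzero integer \<open>M * B n - N * A n\<close> has absolute value at least \<open>1\<close>. It equals
  \<open>N * (B n * \<tau> - A n) - B n * (N * \<tau> - M)\<close>, and the first of these terms is at most \<open>1/2\<close> by the
  smallness assumption, so the second is at least \<open>1/2\<close>.
\<close>

lemma value_far_from_fraction:
  fixes M N :: int
  assumes lim: "(\<lambda>n. of_int (P n) / of_int (B n) :: real) \<longlonglongrightarrow> 0"
    and N: "N > 0" and small: "2 * real_of_int N \<le> of_int (B (Suc n)) / of_int (P (Suc n))"
    and neq: "M * B n \<noteq> N * A n"
  shows "\<bar>gcf_value a b - of_int M / of_int N\<bar> \<ge> 1 / (2 * of_int N * of_int (B n))"
proof -
  define \<tau> where "\<tau> = gcf_value a b"
  define p q where "p = real_of_int (A n)" and "q = real_of_int (B n)"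
  have q: "q > 0" using B_pos by (simp add: q_def)
  have "1 \<le> \<bar>M * B n - N * A n\<bar>" using neq by linarith
  then have "1 \<le> \<bar>real_of_int (M * B n - N * A n)\<bar>" by linarith
  then have one: "1 \<le> \<bar>of_int M * q - of_int N * p\<bar>" by (simp add: p_def q_def)
  have "of_int M * q - of_int N * p
        = of_int N * q * ((\<tau> - p / q) - (\<tau> - of_int M / of_int N))"
    using N q by (simp add: field_simps)
  then have "\<bar>of_int M * q - of_int N * p\<bar>
        = of_int N * q * \<bar>(\<tau> - p / q) - (\<tau> - of_int M / of_int N)\<bar>"
    using N q by (simp add: abs_mult)
  also have "\<dots> \<le> of_int N * q * (\<bar>\<tau> - p / q\<bar> + \<bar>\<tau> - of_int M / of_int N\<bar>)"
    using N q by (intro mult_left_mono abs_triangle_ineq4) auto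
  also have "\<dots> = of_int N * q * \<bar>\<tau> - p / q\<bar> + of_int N * q * \<bar>\<tau> - of_int M / of_int N\<bar>"
    by (simp add: algebra_simps)
  also have "of_int N * q * \<bar>\<tau> - p / q\<bar> \<le> of_int N * q * gap n"
    using gcf_error[OF lim, of n] N q
    by (intro mult_left_mono) (auto simp: \<tau>_def p_def q_def gcf_conv_def)
  also have "of_int N * q * gap n = of_int N * (of_int (P (Suc n)) / of_int (B (Suc n)))"
    using q by (simp add: gap_def q_def)
  also have "\<dots> \<le> 1 / 2"
    using small P_pos[of "Suc n"] B_pos[of "Suc n"] by (simp add: field_simps del: gcf_denom.simps)
  finally have "1 / 2 \<le> of_int N * q * \<bar>\<tau> - of_int M / of_int N\<bar>"
    using one by linarith
  then show ?thesis
    using N q by (simp add: \<tau>_def q_def field_simps)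
qed

text \<open>
  The criterion that turns growth of the denominators into an irrationality exponent: a fraction
  \<open>M / N\<close> is compared with the two convergents at the point where \<open>B n / P n\<close> passes \<open>2 * N\<close>.
  Because \<open>B n / P n < 2 * N\<close> there, the growth hypothesis bounds \<open>B (n + 1)\<close> by a constant
  times \<open>N powr (\<mu> - 1)\<close>.
\<close>

lemma irrationality_exponentI:
  assumes lim: "filterlim (\<lambda>n. of_int (B n) / of_int (P n) :: real) at_top sequentially"
    and \<mu>: "\<mu> \<ge> 1"
    and growth: "eventually (\<lambda>n. of_int (B (Suc n))
                   \<le> (of_int (B n) / of_int (P n) :: real) powr (\<mu> - 1)) sequentially"
  shows "irrationality_exponent (gcf_value a b) \<mu>"
proof -
  define Q :: "nat \<Rightarrow> real" where "Q n = of_int (B n) / of_int (P n)" for n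
  have Q_pos: "Q n > 0" for n
    using B_pos[of n] P_pos[of n] by (simp add: Q_def)
  have lim0: "(\<lambda>n. of_int (P n) / of_int (B n) :: real) \<longlonglongrightarrow> 0"
    using tendsto_inverse_0_at_top[OF lim] by simp
  obtain n1 where n1: "\<And>n. n \<ge> n1 \<Longrightarrow> of_int (B (Suc n)) \<le> Q n powr (\<mu> - 1)"
    using growth by (auto simp: eventually_sequentially Q_def)
  define c where "c = 1 / (2 * 2 powr (\<mu> - 1))"
  have "\<bar>gcf_value a b - of_int M / of_int N\<bar> \<ge> c / of_int N powr \<mu>"
    if N: "real_of_int N \<ge> Q n1" for M N :: int
  proof -
    have N_pos: "N > 0" using N Q_pos[of n1] by linarith
    obtain n2 where n2: "\<And>n. n \<ge> n2 \<Longrightarrow> Q n \<ge> 2 * real_of_int N"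
      using lim by (auto simp: filterlim_at_top eventually_sequentially Q_def)
    \<comment> \<open>The quotients \<open>Q n\<close> need not be monotone, so the index is taken as the last one below
        \<open>2 * N\<close>: everything after it is then above.\<close>
    define I where "I = {n. Q n < 2 * real_of_int N}"
    have "I \<subseteq> {..<n2}" using n2 by (force simp: I_def not_le[symmetric])
    then have fin: "finite I" by (rule finite_subset) simp
    have "n1 \<in> I" using N N_pos Q_pos[of n1] by (simp add: I_def)
    define n where "n = Max I"
    have "n \<in> I" using fin \<open>n1 \<in> I\<close> by (auto simp: n_def intro: Max_in)
    have "n \<ge> n1" using fin \<open>n1 \<in> I\<close> by (simp add: n_def)
    have beyond: "2 * real_of_int N \<le> Q m" if "m > n" for m
      using that Max_ge[OF fin, of m] by (force simp: n_def I_def)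
    have "of_int (B (Suc n)) \<le> Q n powr (\<mu> - 1)"
      using n1 \<open>n \<ge> n1\<close> by blast
    also have "\<dots> \<le> (2 * of_int N) powr (\<mu> - 1)"
      using \<mu> Q_pos[of n] \<open>n \<in> I\<close> by (intro powr_mono2) (auto simp: I_def)
    also have "\<dots> = 2 powr (\<mu> - 1) * of_int N powr (\<mu> - 1)"
      using N_pos by (simp add: powr_mult)
    also have "\<dots> = 2 powr (\<mu> - 1) * (of_int N powr \<mu> / of_int N)"
      using N_pos by (simp add: powr_diff)
    finally have B_le: "of_int (B (Suc n)) * of_int N \<le> 2 powr (\<mu> - 1) * (of_int N :: real) powr \<mu>"
      using N_pos by (simp add: field_simps)
    \<comment> \<open>Consecutive convergents are distinct, so one of them differs from \<open>M / N\<close>.\<close>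
    have "\<exists>m \<in> {n, Suc n}. M * B m \<noteq> N * A m"
    proof (rule ccontr)
      assume "\<not> ?thesis"
      then have eq: "M * B n = N * A n" "M * B (Suc n) = N * A (Suc n)" by auto
      have "N * (A (Suc n) * B n - A n * B (Suc n))
            = (N * A (Suc n)) * B n - (N * A n) * B (Suc n)"
        by (simp only: algebra_simps)
      also have "\<dots> = 0" by (simp only: eq[symmetric]) (simp only: algebra_simps)
      finally have "N * ((-1) ^ n * P (Suc n)) = 0" by (simp only: determinant)
      then show False using N_pos P_pos[of "Suc n"] by simp
    qed
    then obtain m where m: "m \<in> {n, Suc n}" "M * B m \<noteq> N * A m" by blast
    have "B m \<le> B (Suc n)" using m(1) B_le_Suc[of n] by auto
    have "c / of_int N powr \<mu> = 1 / (2 * (2 powr (\<mu> - 1) * of_int N powr \<mu>))"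
      by (simp add: c_def)
    also have "\<dots> \<le> 1 / (2 * (of_int (B (Suc n)) * of_int N))"
      using B_le B_pos[of "Suc n"] N_pos by (intro divide_left_mono mult_left_mono) auto
    also have "\<dots> \<le> 1 / (2 * (of_int (B m) * of_int N))"
      using \<open>B m \<le> B (Suc n)\<close> B_pos[of m] B_pos[of "Suc n"] N_pos
      by (intro divide_left_mono mult_left_mono mult_right_mono) auto
    also have "\<dots> = 1 / (2 * of_int N * of_int (B m))" by (simp add: mult_ac)
    also have "\<dots> \<le> \<bar>gcf_value a b - of_int M / of_int N\<bar>"
      using m beyond[of "Suc m"] N_pos
      by (intro value_far_from_fraction[OF lim0]) (auto simp: Q_def simp del: gcf_denom.simps)
    finally show ?thesis .
  qed
  moreover have "c > 0" by (simp add: c_def)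
  ultimately show ?thesis
    unfolding irrationality_exponent_def using Q_pos by blast
qed

text \<open>
  In logarithmic form the criterion reads \<open>ln B (n + 1) \<le> (\<mu> - 1) * (ln B n - ln P n)\<close>. Since
  \<open>ln B (n + 1)\<close> exceeds \<open>ln B n\<close> by \<open>o(S n)\<close> only, it holds eventually once the coefficient
  \<open>(\<mu> - 2) * D - (\<mu> - 1) * C\<close> of \<open>S n\<close> in the difference of both sides is positive, that is, for
  \<open>\<mu> > 2 + C / (D - C)\<close>.
\<close>

lemma gcf_log_growth:
  fixes S f g h :: "nat \<Rightarrow> real"
  assumes S: "filterlim S at_top sequentially"
    and f: "f \<in> o(S)" and g: "g \<in> o(S)" and h: "h \<in> o(S)"
    and lnB: "\<And>n. ln (of_int (B n)) \<ge> D * S n - f n"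
    and lnP: "\<And>n. ln (of_int (P n)) \<le> C * S n + g n"
    and step: "\<And>n. ln (of_int (B (Suc n))) \<le> ln (of_int (B n)) + h n"
    and "C < D"
  shows "convergent (gcf_conv a b)"
    and "gcf_value a b \<notin> \<rat>"
    and "asymp_irrationality_exponent (gcf_value a b) \<le> ereal (2 + C / (D - C))"
proof -
  define u v where "u n = ln (real_of_int (B n))" and "v n = ln (real_of_int (P n))" for n
  have v_nonneg: "v n \<ge> 0" for n
    using P_pos[of n] by (simp add: v_def)
  have dominate: "eventually (\<lambda>n. F n \<le> e * S n) sequentially" if "F \<in> o(S)" "e > 0" for F e
  proof -
    have "eventually (\<lambda>n. norm (F n) \<le> e * norm (S n)) sequentially"
      using landau_o.smallD[OF that] .
    moreover have "eventually (\<lambda>n. S n \<ge> 0) sequentially"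
      using S by (simp add: filterlim_at_top)
    ultimately show ?thesis by eventually_elim auto
  qed
  \<comment> \<open>A negative \<open>C\<close> would make \<open>ln (P n)\<close> negative for large \<open>n\<close>. The sign is needed to have
      \<open>\<mu> > 2\<close> below, so that the lower bound for \<open>ln (B n)\<close> may be multiplied by \<open>\<mu> - 2\<close>.\<close>
  have "C \<ge> 0"
  proof (rule ccontr)
    assume "\<not> C \<ge> 0"
    then have "eventually (\<lambda>n. g n \<le> (- C / 2) * S n) sequentially"
      by (intro dominate g) auto
    moreover have "eventually (\<lambda>n. S n \<ge> 1) sequentially"
      using S by (simp add: filterlim_at_top)
    ultimately have "eventually (\<lambda>n. False) sequentially"
    proof eventually_elim
      case (elim n)
      have "0 \<le> C * S n + g n" using lnP[of n] v_nonneg[of n] by (simp add: v_def)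
      also have "\<dots> \<le> (C / 2) * S n" using elim by (simp add: field_simps)
      also have "\<dots> < 0" using elim \<open>\<not> C \<ge> 0\<close> by (intro mult_neg_pos) auto
      finally show False by simp
    qed
    then show False by simp
  qed
  define m where "m = 2 + C / (D - C)"
  have ln_Q: "ln (real_of_int (B n) / of_int (P n)) = u n - v n" for n
    using B_pos[of n] P_pos[of n] by (simp add: ln_div u_def v_def)
  have lim: "filterlim (\<lambda>n. of_int (B n) / of_int (P n) :: real) at_top sequentially"
  proof -
    have "filterlim (\<lambda>n. (D - C) / 2 * S n) at_top sequentially"
      using S \<open>C < D\<close> by (intro filterlim_tendsto_pos_mult_at_top[OF tendsto_const]) auto
    moreover have "eventually (\<lambda>n. f n + g n \<le> (D - C) / 2 * S n) sequentially"
      using \<open>C < D\<close> by (intro dominate sum_in_smallo f g) auto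
    then have "eventually (\<lambda>n. (D - C) / 2 * S n \<le> u n - v n) sequentially"
    proof eventually_elim
      case (elim n)
      then show ?case using lnB[of n] lnP[of n] by (simp add: u_def v_def field_simps)
    qed
    ultimately have "filterlim (\<lambda>n. u n - v n) at_top sequentially"
      by (rule filterlim_at_top_mono)
    then have "filterlim (\<lambda>n. exp (u n - v n)) at_top sequentially"
      by (rule filterlim_compose[OF exp_at_top])
    moreover have "exp (u n - v n) = of_int (B n) / of_int (P n)" for n
      using B_pos[of n] P_pos[of n] by (simp add: exp_diff u_def v_def)
    ultimately show ?thesis by simp
  qed
  have exponent: "irrationality_exponent (gcf_value a b) \<mu>" if \<mu>: "\<mu> > m" for \<mu>
  proof (rule irrationality_exponentI[OF lim])
    have "\<mu> > 2" using \<mu> \<open>C \<ge> 0\<close> \<open>C < D\<close> by (auto simp: m_def intro: le_less_trans[rotated])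
    then show "\<mu> \<ge> 1" by simp
    define e where "e = (\<mu> - 2) * D - (\<mu> - 1) * C"
    have "(\<mu> - 2) * (D - C) > C"
      using \<mu> \<open>C < D\<close> by (simp add: m_def field_simps)
    then have "e > 0" by (simp add: e_def algebra_simps)
    have "eventually (\<lambda>n. (\<mu> - 2) * f n + (\<mu> - 1) * g n + h n \<le> e * S n) sequentially"
      using \<open>\<mu> > 2\<close> \<open>e > 0\<close> f g h by (intro dominate sum_in_smallo) auto
    then show "eventually (\<lambda>n. of_int (B (Suc n))
                   \<le> (of_int (B n) / of_int (P n) :: real) powr (\<mu> - 1)) sequentially"
    proof eventually_elim
      case (elim n)
      have "(\<mu> - 2) * (D * S n - f n) \<le> (\<mu> - 2) * u n"
        using lnB[of n] \<open>\<mu> > 2\<close> by (intro mult_left_mono) (auto simp: u_def)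
      moreover have "(\<mu> - 1) * v n \<le> (\<mu> - 1) * (C * S n + g n)"
        using lnP[of n] \<open>\<mu> > 2\<close> by (intro mult_left_mono) (auto simp: v_def)
      ultimately have "(\<mu> - 2) * u n - (\<mu> - 1) * v n \<ge> h n"
        using elim by (simp add: e_def algebra_simps)
      then have "u (Suc n) \<le> (\<mu> - 1) * (u n - v n)"
        using step[of n] by (simp add: u_def algebra_simps)
      then have "exp (u (Suc n)) \<le> exp ((\<mu> - 1) * (u n - v n))" by simp
      then show ?case
        using B_pos[of n] B_pos[of "Suc n"] P_pos[of n]
        by (simp add: powr_def ln_Q u_def del: gcf_denom.simps)
    qed
  qed
  have "(\<lambda>n. of_int (P n) / of_int (B n) :: real) \<longlonglongrightarrow> 0"
    using tendsto_inverse_0_at_top[OF lim] by simp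
  then show "convergent (gcf_conv a b)" by (rule gcf_convergent)
  show "gcf_value a b \<notin> \<rat>"
    using exponent[of "m + 1"] irrationality_exponent_imp_irrational by simp
  show "asymp_irrationality_exponent (gcf_value a b) \<le> ereal (2 + C / (D - C))"
  proof (rule ereal_le_epsilon2)
    fix e :: real assume "e > 0"
    then have "irrationality_exponent (gcf_value a b) (m + e)" by (intro exponent) simp
    then show "asymp_irrationality_exponent (gcf_value a b) \<le> ereal (2 + C / (D - C)) + ereal e"
      unfolding asymp_irrationality_exponent_def m_def by (intro Inf_lower) auto
  qed
qed

lemma ln_P: "ln (real_of_int (P n)) = (\<Sum>i = 1..n. ln (real_of_int (a i)))"
  unfolding P_def of_int_prod by (rule ln_prod) (use a_pos in force)+

lemma ln_B_ge: "ln (real_of_int (B n)) \<ge> (\<Sum>i = 1..n. ln (real_of_int (b i)))"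
proof (induction n)
  case (Suc n)
  have "ln (real_of_int (b (Suc n))) + ln (real_of_int (B n)) = ln (real_of_int (b (Suc n) * B n))"
    using b_pos[of "Suc n"] B_pos[of n] by (simp add: ln_mult)
  also have "\<dots> \<le> ln (real_of_int (B (Suc n)))"
    using b_pos[of "Suc n"] B_pos[of n] B_pos[of "Suc n"] B_Suc_ge[of n]
    by (intro ln_mono) (auto simp only: of_int_le_iff of_int_0_less_iff intro!: mult_pos_pos)
  finally show ?case using Suc by simp
qed simp

lemma ln_B_Suc_le:
  "ln (real_of_int (B (Suc n)))
     \<le> ln (real_of_int (B n)) + (ln 2 + ln (real_of_int (a (Suc n))) + ln (real_of_int (b (Suc n))))"
proof -
  have "real_of_int (B (Suc n)) \<le> real_of_int (2 * (a (Suc n) * b (Suc n) * B n))"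
    using B_Suc_le[of n] by (simp only: of_int_le_iff)
  then have "ln (real_of_int (B (Suc n))) \<le> ln (real_of_int (2 * (a (Suc n) * b (Suc n) * B n)))"
    using B_pos[of "Suc n"] by (intro ln_mono) (auto simp del: gcf_denom.simps)
  also have "\<dots> = ln (real_of_int (B n))
      + (ln 2 + ln (real_of_int (a (Suc n))) + ln (real_of_int (b (Suc n))))"
    using a_pos[of "Suc n"] b_pos[of "Suc n"] B_pos[of n] by (simp add: ln_mult)
  finally show ?thesis .
qed

end

section \<open>Power sums\<close>

definition power_sum :: "real \<Rightarrow> nat \<Rightarrow> real" where
  "power_sum k n = (\<Sum>i = 1..n. real i powr k)"

lemma power_sum_le:
  assumes "k \<ge> 0"
  shows "power_sum k n \<le> real n powr (k + 1)"
proof -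
  have "power_sum k n \<le> (\<Sum>i = 1..n. real n powr k)"
    unfolding power_sum_def using assms by (intro sum_mono powr_mono2) auto
  then show ?thesis by (cases "n = 0") (simp_all add: powr_add mult.commute)
qed

text \<open>
  Of the two indices \<open>i\<close> and \<open>n + 1 - i\<close> at least one is \<open>n / 2\<close> or more, so adding the sum to
  its own reversal gives \<open>n\<close> terms that are each at least \<open>(n / 2) powr k\<close>.
\<close>

lemma power_sum_ge:
  assumes "k \<ge> 0"
  shows "real n powr (k + 1) \<le> 2 powr (k + 1) * power_sum k n"
proof -
  have "(real n / 2) powr k \<le> real i powr k + real (n + 1 - i) powr k" if "i \<in> {1..n}" for i
  proof (cases "real i \<ge> real n / 2")
    case True
    then have "(real n / 2) powr k \<le> real i powr k" using assms by (intro powr_mono2) auto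
    then show ?thesis by (intro add_increasing2) auto
  next
    case False
    then have "(real n / 2) powr k \<le> real (n + 1 - i) powr k"
      using assms that by (intro powr_mono2) (auto simp: of_nat_diff)
    then show ?thesis by (intro add_increasing) auto
  qed
  then have "(\<Sum>i = 1..n. (real n / 2) powr k) \<le> (\<Sum>i = 1..n. real i powr k + real (n + 1 - i) powr k)"
    by (rule sum_mono)
  also have "\<dots> = power_sum k n + (\<Sum>i = 1..n. real (n + 1 - i) powr k)"
    by (simp add: sum.distrib power_sum_def)
  also have "(\<Sum>i = 1..n. real (n + 1 - i) powr k) = power_sum k n"
    unfolding power_sum_def
    by (rule sum.reindex_bij_witness[of _ "\<lambda>i. n + 1 - i" "\<lambda>i. n + 1 - i"]) auto
  finally have "real n * (real n / 2) powr k \<le> 2 * power_sum k n" by simp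
  then show ?thesis
    by (cases "n = 0") (simp_all add: powr_add powr_divide field_simps)
qed

lemma smallo_power_sum:
  assumes "k \<ge> 0" and "f \<in> o(\<lambda>n. real n powr (k + 1))"
  shows "f \<in> o(power_sum k)"
proof (rule landau_o.small_big_trans[OF assms(2)])
  show "(\<lambda>n. real n powr (k + 1)) \<in> O(power_sum k)"
  proof (rule bigoI[of _ "2 powr (k + 1)"], intro always_eventually allI)
    fix n
    have "power_sum k n \<ge> 0" by (simp add: power_sum_def sum_nonneg)
    then show "norm (real n powr (k + 1)) \<le> 2 powr (k + 1) * norm (power_sum k n)"
      using power_sum_ge[OF assms(1), of n] by simp
  qed
qed

lemma power_sum_smallo_power_sum:
  assumes "0 \<le> l" "l < k"
  shows "power_sum l \<in> o(power_sum k)"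
proof (rule smallo_power_sum)
  have "power_sum l \<in> O(\<lambda>n. real n powr (l + 1))"
  proof (rule bigoI[of _ 1], intro always_eventually allI)
    fix n
    have "power_sum l n \<ge> 0" by (simp add: power_sum_def sum_nonneg)
    then show "norm (power_sum l n) \<le> 1 * norm (real n powr (l + 1))"
      using power_sum_le[OF assms(1), of n] by simp
  qed
  also have "(\<lambda>n. real n powr (l + 1)) \<in> o(\<lambda>n. real n powr (k + 1))"
    using assms by real_asymp
  finally show "power_sum l \<in> o(\<lambda>n. real n powr (k + 1))" .
qed (use assms in simp)

lemma filterlim_power_sum:
  assumes "k \<ge> 0"
  shows "filterlim (power_sum k) at_top sequentially"
proof (rule filterlim_at_top_mono)
  show "filterlim (\<lambda>n. real n powr (k + 1) / 2 powr (k + 1)) at_top sequentially"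
    using assms by real_asymp
  show "eventually (\<lambda>n. real n powr (k + 1) / 2 powr (k + 1) \<le> power_sum k n) sequentially"
    using power_sum_ge[OF assms] by (simp add: field_simps)
qed

section \<open>The exponents of rapidly growing continued fractions\<close>

theorem theorem5p1:
  fixes a b :: "nat \<Rightarrow> int"
    and l r s\<^sub>1 s\<^sub>2 \<alpha> \<beta>\<^sub>1 \<beta>\<^sub>2 k\<^sub>1 k\<^sub>2 :: real
  assumes "\<And>n. n \<ge> 1 \<Longrightarrow> a n > 0"
    and "\<And>n. n \<ge> 1 \<Longrightarrow> b n > 0"
    and "l \<ge> 0"
    and "r > 0" "s\<^sub>1 > 0" "s\<^sub>2 > 0" "\<alpha> > 0" "\<beta>\<^sub>1 > 0" "\<beta>\<^sub>2 > 0" "k\<^sub>1 > 0" "k\<^sub>2 > 0"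
    and "k\<^sub>1 + 1 > k\<^sub>2" "k\<^sub>2 \<ge> k\<^sub>1"
    and "\<And>n. n \<ge> 1 \<Longrightarrow> real_of_int (a n) \<le> r * \<alpha> powr (real n powr l)"
    and "\<And>n. n \<ge> 1 \<Longrightarrow> s\<^sub>1 * \<beta>\<^sub>1 powr (real n powr k\<^sub>1) \<le> real_of_int (b n)"
    and "\<And>n. n \<ge> 1 \<Longrightarrow> real_of_int (b n) \<le> s\<^sub>2 * \<beta>\<^sub>2 powr (real n powr k\<^sub>2)"
  shows "(l < k\<^sub>1 \<and> \<beta>\<^sub>1 > 1 \<longrightarrow>
            convergent (gcf_conv a b) \<and>
            gcf_value a b \<notin> \<rat> \<and>
            asymp_irrationality_exponent (gcf_value a b) = 2) \<and>
         (l = k\<^sub>1 \<and> \<alpha> < \<beta>\<^sub>1 \<longrightarrow>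
            convergent (gcf_conv a b) \<and>
            gcf_value a b \<notin> \<rat> \<and>
            asymp_irrationality_exponent (gcf_value a b)
              \<le> ereal (2 + ln \<alpha> / (ln \<beta>\<^sub>1 - ln \<alpha>)))"
proof -
  interpret positive_gcf a b
    by standard (use assms(1,2) in auto)
  note pos = assms(4-11)
  have ln_a: "ln (of_int (a n)) \<le> ln r + ln \<alpha> * real n powr l" if "n \<ge> 1" for n
  proof -
    have "ln (of_int (a n)) \<le> ln (r * \<alpha> powr (real n powr l))"
      using assms(1,14)[OF that] by (intro ln_mono) auto
    then show ?thesis using pos by (simp add: ln_mult ln_powr mult.commute)
  qed
  have ln_b_lower: "ln s\<^sub>1 + ln \<beta>\<^sub>1 * real n powr k\<^sub>1 \<le> ln (of_int (b n))" if "n \<ge> 1" for n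
  proof -
    have "ln (s\<^sub>1 * \<beta>\<^sub>1 powr (real n powr k\<^sub>1)) \<le> ln (of_int (b n))"
      using pos assms(15)[OF that] by (intro ln_mono) auto
    then show ?thesis using pos by (simp add: ln_mult ln_powr mult.commute)
  qed
  have ln_b_upper: "ln (of_int (b n)) \<le> ln s\<^sub>2 + ln \<beta>\<^sub>2 * real n powr k\<^sub>2" if "n \<ge> 1" for n
  proof -
    have "ln (of_int (b n)) \<le> ln (s\<^sub>2 * \<beta>\<^sub>2 powr (real n powr k\<^sub>2))"
      using assms(2,16)[OF that] by (intro ln_mono) auto
    then show ?thesis using pos by (simp add: ln_mult ln_powr mult.commute)
  qed
  \<comment> \<open>Summed over \<open>i \<le> n\<close>, the constants \<open>s\<^sub>1\<close> and \<open>r\<close> contribute only terms linear in \<open>n\<close>;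
      \<open>f\<close> and \<open>h\<close> are the resulting error terms for \<open>ln (B n)\<close> and for a single step.\<close>
  define S where "S = power_sum k\<^sub>1"
  define f where "f n = - ln s\<^sub>1 * real n" for n
  define h where "h n = (ln 2 + (ln r + ln \<alpha> * real (Suc n) powr l))
      + (ln s\<^sub>2 + ln \<beta>\<^sub>2 * real (Suc n) powr k\<^sub>2)" for n
  have S_lim: "filterlim S at_top sequentially"
    unfolding S_def using pos by (intro filterlim_power_sum) auto
  have linear: "(\<lambda>n. c * real n) \<in> o(S)" for c
    unfolding S_def
  proof (rule smallo_power_sum)
    show "(\<lambda>n. c * real n) \<in> o(\<lambda>n. real n powr (k\<^sub>1 + 1))"
    proof -
      have "(\<lambda>n. real n) \<in> o(\<lambda>n. real n powr (k\<^sub>1 + 1))"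
        using pos by real_asymp
      then show ?thesis by simp
    qed
  qed (use pos in simp)
  have f: "f \<in> o(S)" unfolding f_def[abs_def] by (rule linear)
  have h: "h \<in> o(S)" if "l \<le> k\<^sub>1"
  proof -
    have pow: "(\<lambda>n. c * real (Suc n) powr p) \<in> o(\<lambda>n. real n powr (k\<^sub>1 + 1))"
      if "0 \<le> p" "p < k\<^sub>1 + 1" for c p
    proof -
      have "(\<lambda>n. real (Suc n) powr p) \<in> o(\<lambda>n. real n powr (k\<^sub>1 + 1))"
        using that pos by real_asymp
      then show ?thesis by simp
    qed
    have const: "(\<lambda>n. c) \<in> o(\<lambda>n. real n powr (k\<^sub>1 + 1))" for c :: real
      using pos by real_asymp
    show ?thesis
      unfolding h_def[abs_def] S_def using pos assms(3,12) that
      by (intro smallo_power_sum sum_in_smallo pow const) auto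
  qed
  have lnB: "ln (of_int (B n)) \<ge> ln \<beta>\<^sub>1 * S n - f n" for n
  proof -
    have "ln \<beta>\<^sub>1 * S n - f n = (\<Sum>i = 1..n. ln s\<^sub>1 + ln \<beta>\<^sub>1 * real i powr k\<^sub>1)"
      by (simp add: S_def f_def power_sum_def sum.distrib sum_distrib_left)
    also have "\<dots> \<le> (\<Sum>i = 1..n. ln (of_int (b i)))"
      by (intro sum_mono ln_b_lower) auto
    also have "\<dots> \<le> ln (of_int (B n))" by (rule ln_B_ge)
    finally show ?thesis .
  qed
  have lnP: "ln (of_int (P n)) \<le> ln r * real n + ln \<alpha> * power_sum l n" for n
  proof -
    have "ln (of_int (P n)) \<le> (\<Sum>i = 1..n. ln r + ln \<alpha> * real i powr l)"
      unfolding ln_P by (intro sum_mono ln_a) auto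
    then show ?thesis by (simp add: power_sum_def sum.distrib sum_distrib_left mult.commute)
  qed
  have step: "ln (of_int (B (Suc n))) \<le> ln (of_int (B n)) + h n" for n
    using ln_B_Suc_le[of n] ln_a[of "Suc n"] ln_b_upper[of "Suc n"] unfolding h_def by linarith
  show ?thesis
  proof (intro conjI[of "_ \<longrightarrow> _"] impI)
    assume *: "l < k\<^sub>1 \<and> \<beta>\<^sub>1 > 1"
    \<comment> \<open>As \<open>l < k\<^sub>1\<close>, even the leading term of \<open>ln (P n)\<close> is negligible, whatever the sign of
        \<open>ln \<alpha>\<close>; so the growth lemma applies with \<open>C = 0\<close>.\<close>
    define g where "g n = ln r * real n + ln \<alpha> * power_sum l n" for n
    have "power_sum l \<in> o(S)"
      unfolding S_def using assms(3) * by (intro power_sum_smallo_power_sum) auto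
    then have g: "g \<in> o(S)"
      unfolding g_def[abs_def] by (intro sum_in_smallo linear) simp
    have lnP': "ln (of_int (P n)) \<le> 0 * S n + g n" for n
      using lnP[of n] by (simp add: g_def)
    note growth = gcf_log_growth[OF S_lim f g h lnB lnP' step]
    have "asymp_irrationality_exponent (gcf_value a b) \<le> 2"
      using growth(3) * by simp
    moreover have "asymp_irrationality_exponent (gcf_value a b) \<ge> 2"
      unfolding asymp_irrationality_exponent_def
      by (intro Inf_greatest) (auto dest: irrationality_exponent_ge_2)
    ultimately show "convergent (gcf_conv a b) \<and> gcf_value a b \<notin> \<rat> \<and>
        asymp_irrationality_exponent (gcf_value a b) = 2"
      using growth(1,2) * by auto
  next
    assume *: "l = k\<^sub>1 \<and> \<alpha> < \<beta>\<^sub>1"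
    have lnP': "ln (of_int (P n)) \<le> ln \<alpha> * S n + ln r * real n" for n
      using lnP[of n] * by (simp add: S_def)
    have "ln \<alpha> < ln \<beta>\<^sub>1" using * pos by simp
    with gcf_log_growth[OF S_lim f linear h lnB lnP' step] *
    show "convergent (gcf_conv a b) \<and> gcf_value a b \<notin> \<rat> \<and>
        asymp_irrationality_exponent (gcf_value a b) \<le> ereal (2 + ln \<alpha> / (ln \<beta>\<^sub>1 - ln \<alpha>))"
      by auto
  qed
qed

end
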